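(* Let $m, n, r$ be nonnegative integers with $1 \le r \le m+n$. Then $$\sum_{k=0}^{r} k\binom{m}{k}\binom{n}{r-k} = m\binom{m+n-1}{r-1},$$ where the terms of the sum with $k>m$ or $r-k>n$ are taken to be $0$.
   Context: For nonnegative integers $x \ge y$, $\binom{x}{y}=\frac{x!}{(x-y)!\,y!}$; for nonnegative integers $y > x$, $\binom{x}{y}=0$. *)

theory Defs
  imports Complex_Main
begin

end

theory Submission
  imports Defs
begin

text \<open>For positive \<open>m\<close>, absorption (\<open>Suc_times_binomial\<close>) turns
  \<open>k * (m choose k)\<close> into \<open>m * ((m - 1) choose (k - 1))\<close>. The factor
  \<open>m\<close> leaves the sum, and what remains is the Vandermonde convolution of
  \<open>m - 1\<close> and \<open>n\<close> at \<open>r - 1\<close>.\<close>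

theorem theorem2p1:
  fixes m n r :: nat
  assumes "1 \<le> r" and "r \<le> m + n"
  shows "(\<Sum>k=0..r. k * (m choose k) * (n choose (r - k))) = m * ((m + n - 1) choose (r - 1))"
proof (cases m)
  case 0
  have "k * (0 choose k) = 0" for k :: nat
    by (cases k) auto
  with 0 show ?thesis by simp
next
  case (Suc p)
  obtain s where s: "r = Suc s"
    using assms(1) by (cases r) auto
  \<comment> \<open>The term at \<open>k = 0\<close> vanishes, so the index can be shifted to the
    successor form that absorption needs.\<close>
  have "(\<Sum>k=0..r. k * (m choose k) * (n choose (r - k)))
      = (\<Sum>k=0..s. Suc k * (Suc p choose Suc k) * (n choose (s - k)))"
    unfolding s Suc sum.atLeast0_atMost_Suc_shift by simp
  also have "\<dots> = (\<Sum>k\<le>s. Suc p * ((p choose k) * (n choose (s - k))))"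
    by (simp only: Suc_times_binomial atLeast0AtMost mult.assoc)
  also have "\<dots> = Suc p * ((p + n) choose s)"
    by (simp only: vandermonde flip: sum_distrib_left)
  finally show ?thesis
    by (simp add: s Suc)
qed

end
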